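(* Let $n\ge 1$, let $q:\mathbb{R}^n\to\mathbb{R}^n$, and put $r(x)=x-q(x)$. Assume there are $x^*\in\mathbb{R}^n$, $\hat\delta>0$ and $\rho\in(0,1)$ such that, with $\mathcal{B}(\hat\delta)=\{x:\|x-x^*\|_2\le\hat\delta\}$: (i) $q(x^* )=x^*$; (ii) $q$ is Lipschitz continuously differentiable in $\mathcal{B}(\hat\delta)$; (iii) $\|q(x)-q(y)\|_2\le\rho\|x-y\|_2$ for all $x,y\in\mathcal{B}(\hat\delta)$. Assume that $x_0\in\mathcal{B}(\hat\delta)$ and that $\rho$ is small enough so that $$\eta=\frac{\rho(1+\rho)}{1-\rho}<1,$$ i.e. $0<\rho<\sqrt2-1$. Let $(x_k)_{k\ge 0}$ be generated from $x_0$ by NGMRES(0), with coefficients determined by $\ell_2$ (least-squares) minimization. Then the residuals $r(x_k)$ converge q-linearly to $0$ with q-factor $\eta$, that is, $$\|r(x_{k})\|_2\le\eta\,\|r(x_{k-1})\|_2\qquad\text{for all }k\ge 1.$$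
   Context: NGMRES(0) (nonlinear GMRES with window size $0$) for the fixed-point map $q$, with $r(x)=x-q(x)$: given $x_0\in\mathbb{R}^n$, for $k=0,1,2,\dots$, $$x_{k+1}=q(x_k)+\beta_0^{(k)}\big(q(x_k)-x_k\big),$$ where $\beta_0^{(k)}\in\mathbb{R}$ minimizes $\beta\mapsto\big\|r(q(x_k))+\beta\big(r(q(x_k))-r(x_k)\big)\big\|_2^2$. Whenever $r(q(x_k))\ne r(x_k)$ this is $$\beta_0^{(k)}=-\frac{r(q(x_k))^T\big(r(q(x_k))-r(x_k)\big)}{\|r(q(x_k))-r(x_k)\|_2^2}.$$ If $r(x_k)=0$, then $q(x_k)=x_k$ and $x_{k+1}=x_k$ whatever the value of $\beta_0^{(k)}$. A sequence $\{y_k\}$ converges q-linearly to $y^*$ with q-factor $\varrho\in(0,1)$ if $\|y_k-y^*\|\le\varrho\|y_{k-1}-y^*\|$ for all $k\ge 1$. "Lipschitz continuously differentiable in $\mathcal{B}(\hat\delta)$" means that $q$ is differentiable there with Lipschitz continuous derivative $q'$. *)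

theory Defs
  imports "HOL-Analysis.Analysis"
begin

definition residual :: "('a::real_vector \<Rightarrow> 'a) \<Rightarrow> 'a \<Rightarrow> 'a" where
  "residual q x = x - q x"

text \<open>Derivatives at boundary points of \<open>S\<close> are taken relative to \<open>S\<close>, which is implied by
  differentiability in the full space. Lipschitz continuity of the derivative is with respect
  to the operator norm, i.e. the norm of the type of bounded linear maps.\<close>
definition lipschitz_continuously_differentiable_on ::
    "('a::real_normed_vector \<Rightarrow> 'b::real_normed_vector) \<Rightarrow> 'a set \<Rightarrow> bool" where
  "lipschitz_continuously_differentiable_on q S \<longleftrightarrow>
     (\<exists>q' :: 'a \<Rightarrow> 'a \<Rightarrow>\<^sub>L 'b.
        (\<forall>x\<in>S. (q has_derivative blinfun_apply (q' x)) (at x within S)) \<and>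
        (\<exists>L. L-lipschitz_on S q'))"

text \<open>The minimizer is unique unless \<open>residual q (q (x k)) = residual q (x k)\<close>, in which case
  every real number is one, so the coefficients are not a function of \<open>x\<close>.\<close>
definition ngmres0 ::
    "('a::real_normed_vector \<Rightarrow> 'a) \<Rightarrow> (nat \<Rightarrow> real) \<Rightarrow> (nat \<Rightarrow> 'a) \<Rightarrow> bool" where
  "ngmres0 q \<beta> x \<longleftrightarrow>
     (\<forall>k. is_arg_min
            (\<lambda>b. (norm (residual q (q (x k)) +
                        b *\<^sub>R (residual q (q (x k)) - residual q (x k))))\<^sup>2)
            (\<lambda>_. True) (\<beta> k) \<and>
          x (Suc k) = q (x k) + \<beta> k *\<^sub>R (q (x k) - x k))"

definition converges_q_linearly ::
    "(nat \<Rightarrow> 'a::real_normed_vector) \<Rightarrow> 'a \<Rightarrow> real \<Rightarrow> bool" where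
  "converges_q_linearly y y_lim \<theta> \<longleftrightarrow>
     0 < \<theta> \<and> \<theta> < 1 \<and>
     (\<forall>k\<ge>1. norm (y k - y_lim) \<le> \<theta> * norm (y (k - 1) - y_lim))"

end

theory Submission
  imports Defs
begin

text \<open>Fix a step and put \<open>u = x k\<close>, \<open>v = q u\<close>, \<open>w = x (Suc k)\<close>, \<open>a = residual q v\<close> and
  \<open>c = a - residual q u\<close>. Minimality means that \<open>a + \<beta> c\<close> is orthogonal to \<open>c\<close>, so
  \<open>\<parallel>a + \<beta> c\<parallel>\<^sup>2 + \<beta>\<^sup>2\<parallel>c\<parallel>\<^sup>2 = \<parallel>a\<parallel>\<^sup>2 \<le> \<rho>\<^sup>2\<parallel>u - v\<parallel>\<^sup>2\<close>. The residual at \<open>w\<close> differs from the linear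
  model \<open>a + \<beta> c\<close> by at most \<open>2\<rho>\<bar>\<beta>\<bar>\<parallel>u - v\<parallel>\<close>, and \<open>\<parallel>c\<parallel> \<ge> (1 - \<rho>)\<parallel>u - v\<parallel>\<close>; the Cauchy-Schwarz
  inequality in the plane combines the two terms into the factor \<open>\<eta>\<close>. This needs the iterates
  to stay in the ball. For \<open>-1 \<le> \<beta> \<le> 0\<close> that is convexity; for \<open>\<beta> > 0\<close> the point \<open>w\<close>
  overshoots \<open>v\<close>. There, with the fixed point at the origin,
  \<open>2 v \<bullet> (u - v) = \<parallel>u\<parallel>\<^sup>2 - \<parallel>v\<parallel>\<^sup>2 - \<parallel>u - v\<parallel>\<^sup>2\<close> bounds \<open>a \<bullet> (u - v)\<close> and thereby \<open>\<beta>\<close>, so that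
  \<open>\<beta>\<parallel>u - v\<parallel>\<^sup>2 \<le> \<parallel>u\<parallel>\<^sup>2 - \<parallel>v\<parallel>\<^sup>2\<close>, which is what \<open>\<parallel>w\<parallel> \<le> \<parallel>u\<parallel>\<close> requires.\<close>

text \<open>Completing the square about the vertex \<open>b\<close> of the parabola. For
  \<open>c = 0\<close> the equation is trivial, so it also covers non-unique minimizers.\<close>

lemma is_arg_min_norm_line:
  fixes a c :: "'a::real_inner"
  assumes "is_arg_min (\<lambda>b. (norm (a + b *\<^sub>R c))\<^sup>2) (\<lambda>_. True) \<beta>"
  shows "a \<bullet> c + \<beta> * (c \<bullet> c) = 0"
proof (cases "c = 0")
  case False
  define b where "b = - (a \<bullet> c) / (c \<bullet> c)"
  have cc: "c \<bullet> c > 0" using False by simp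
  have ac: "a \<bullet> c = - b * (c \<bullet> c)" using cc by (simp add: b_def)
  have "(norm (a + \<beta> *\<^sub>R c))\<^sup>2 \<le> (norm (a + b *\<^sub>R c))\<^sup>2"
    using assms by (simp add: is_arg_min_linorder)
  moreover have "(norm (a + t *\<^sub>R c))\<^sup>2 = a \<bullet> a + (t\<^sup>2 - 2 * t * b) * (c \<bullet> c)" for t
    unfolding power2_norm_eq_inner
    by (simp add: inner_add_left inner_add_right inner_commute[of c a] ac algebra_simps
        power2_eq_square)
  ultimately have "(\<beta>\<^sup>2 - 2 * \<beta> * b) * (c \<bullet> c) \<le> (b\<^sup>2 - 2 * b * b) * (c \<bullet> c)"
    by simp
  then have "\<beta>\<^sup>2 - 2 * \<beta> * b \<le> b\<^sup>2 - 2 * b * b"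
    using cc by (metis mult_le_cancel_right_pos)
  then have "(\<beta> - b)\<^sup>2 \<le> 0"
    by (simp add: power2_eq_square algebra_simps)
  then show ?thesis using ac by simp
qed simp

text \<open>Stewart's identity on the line through \<open>u\<close> and \<open>v\<close>; it turns
  staying in the ball into a scalar condition on \<open>b\<close>.\<close>

lemma norm_extrapolation:
  fixes u v :: "'a::real_inner"
  shows "(norm (v + b *\<^sub>R (v - u)))\<^sup>2 =
    (1 + b) * (norm v)\<^sup>2 - b * (norm u)\<^sup>2 + b * (1 + b) * (norm (u - v))\<^sup>2"
  unfolding power2_norm_eq_inner
  by (simp add: inner_add_left inner_add_right inner_diff_left inner_diff_right
      inner_commute[of v u] algebra_simps power2_eq_square)

lemma least_squares_step_bound:
  fixes a r :: "'a::real_inner" and \<rho> \<beta> :: real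
  assumes "0 < \<rho>" and "\<rho> < 1" and a_le: "norm a \<le> \<rho> * norm r"
    and orth: "a \<bullet> (a - r) + \<beta> * ((a - r) \<bullet> (a - r)) = 0"
  shows "(norm (a + \<beta> *\<^sub>R (a - r)))\<^sup>2 + ((1 - \<rho>) * (\<bar>\<beta>\<bar> * norm r))\<^sup>2 \<le> (\<rho> * norm r)\<^sup>2"
proof -
  define c where "c = a - r"
  have ac: "a \<bullet> c = - \<beta> * (c \<bullet> c)" using orth by (simp add: c_def)
  have "(1 - \<rho>) * norm r \<le> norm c"
    using norm_triangle_ineq2[of r a] a_le by (simp add: c_def norm_minus_commute algebra_simps)
  then have "((1 - \<rho>) * norm r)\<^sup>2 \<le> (norm c)\<^sup>2"
    using \<open>\<rho> < 1\<close> by (intro power_mono) auto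
  then have "\<beta>\<^sup>2 * ((1 - \<rho>) * norm r)\<^sup>2 \<le> \<beta>\<^sup>2 * (norm c)\<^sup>2"
    by (intro mult_left_mono) auto
  moreover have "(norm (a + \<beta> *\<^sub>R c))\<^sup>2 = (norm a)\<^sup>2 - \<beta>\<^sup>2 * (norm c)\<^sup>2"
    unfolding power2_norm_eq_inner
    by (simp add: inner_add_left inner_add_right inner_commute[of c a] ac algebra_simps
        power2_eq_square)
  moreover have "(norm a)\<^sup>2 \<le> (\<rho> * norm r)\<^sup>2"
    using a_le by (intro power_mono) auto
  ultimately show ?thesis
    unfolding c_def[symmetric] power_mult_distrib power2_abs by (simp add: mult.left_commute)
qed

text \<open>Cauchy-Schwarz for \<open>(M, B)\<close> against
  \<open>(1 - \<rho>, 2 * \<rho>)\<close>, a vector of length at most \<open>1 + \<rho>\<close>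
  because \<open>\<rho>\<^sup>2 \<le> \<rho>\<close>.\<close>

lemma planar_cauchy_schwarz_bound:
  fixes M B P \<rho> :: real
  assumes "0 \<le> \<rho>" and "\<rho> \<le> 1" and "0 \<le> P" and "M\<^sup>2 + B\<^sup>2 \<le> P\<^sup>2"
  shows "(1 - \<rho>) * M + 2 * \<rho> * B \<le> (1 + \<rho>) * P"
proof (rule power2_le_imp_le)
  have "\<rho> * \<rho> \<le> \<rho> * 1"
    using assms by (intro mult_left_mono) auto
  then have \<rho>: "(1 - \<rho>)\<^sup>2 + (2 * \<rho>)\<^sup>2 \<le> (1 + \<rho>)\<^sup>2"
    by (simp add: power2_eq_square algebra_simps)
  have "((1 - \<rho>) * M + 2 * \<rho> * B)\<^sup>2 + ((1 - \<rho>) * B - 2 * \<rho> * M)\<^sup>2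
      = ((1 - \<rho>)\<^sup>2 + (2 * \<rho>)\<^sup>2) * (M\<^sup>2 + B\<^sup>2)"
    by (simp add: power2_eq_square algebra_simps)
  then have "((1 - \<rho>) * M + 2 * \<rho> * B)\<^sup>2 \<le> ((1 - \<rho>)\<^sup>2 + (2 * \<rho>)\<^sup>2) * (M\<^sup>2 + B\<^sup>2)"
    by (smt (verit) zero_le_power2)
  also have "\<dots> \<le> (1 + \<rho>)\<^sup>2 * P\<^sup>2"
    using \<rho> assms(4) by (intro mult_mono) auto
  finally show "((1 - \<rho>) * M + 2 * \<rho> * B)\<^sup>2 \<le> ((1 + \<rho>) * P)\<^sup>2"
    by (simp add: power_mult_distrib)
qed (use assms in auto)

lemma ngmres0_step_residual:
  fixes q :: "'a::real_inner \<Rightarrow> 'a" and \<rho> \<beta> :: real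
  assumes \<rho>: "0 < \<rho>" "\<rho> < 1"
    and v: "v = q u" and w: "w = v + \<beta> *\<^sub>R (v - u)"
    and orth: "residual q v \<bullet> (residual q v - residual q u)
      + \<beta> * ((residual q v - residual q u) \<bullet> (residual q v - residual q u)) = 0"
    and lip_uv: "norm (q u - q v) \<le> \<rho> * norm (u - v)"
    and lip_wv: "norm (q w - q v) \<le> \<rho> * norm (w - v)"
  shows "norm (residual q w) \<le> \<rho> * (1 + \<rho>) / (1 - \<rho>) * norm (residual q u)"
proof -
  define m where "m = residual q v + \<beta> *\<^sub>R (residual q v - residual q u)"
  define R where "R = norm (residual q u)"
  have R: "norm (u - v) = R" by (simp add: R_def residual_def v)
  have "norm (residual q v) \<le> \<rho> * norm (residual q u)"
    using lip_uv by (simp add: residual_def v)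
  from least_squares_step_bound[OF \<rho> this orth]
  have "(norm m)\<^sup>2 + ((1 - \<rho>) * (\<bar>\<beta>\<bar> * R))\<^sup>2 \<le> (\<rho> * R)\<^sup>2"
    by (simp add: m_def R_def)
  then have main: "(1 - \<rho>) * norm m + 2 * \<rho> * ((1 - \<rho>) * (\<bar>\<beta>\<bar> * R)) \<le> (1 + \<rho>) * (\<rho> * R)"
    using \<rho> by (intro planar_cauchy_schwarz_bound) (auto simp: R_def)
  \<comment> \<open>Linear model plus defect. As \<open>w - v = \<beta> *\<^sub>R (v - u)\<close>,
    contractivity bounds both parts of the defect by
    \<open>\<rho> * (\<bar>\<beta>\<bar> * R)\<close>, hence the factor 2 in
    \<open>main\<close>.\<close>
  have "residual q w = m + (\<beta> *\<^sub>R (q v - q u) - (q w - q v))"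
    by (simp add: m_def residual_def w v algebra_simps)
  then have "norm (residual q w) \<le> norm m + norm (\<beta> *\<^sub>R (q v - q u) - (q w - q v))"
    by (simp only: norm_triangle_ineq)
  also have "\<dots> \<le> norm m + (norm (\<beta> *\<^sub>R (q v - q u)) + norm (q w - q v))"
    by (intro add_left_mono norm_triangle_ineq4)
  also have "\<dots> \<le> norm m + (\<bar>\<beta>\<bar> * (\<rho> * R) + \<rho> * (\<bar>\<beta>\<bar> * R))"
  proof (intro add_mono order_refl)
    show "norm (\<beta> *\<^sub>R (q v - q u)) \<le> \<bar>\<beta>\<bar> * (\<rho> * R)"
      using mult_left_mono[OF lip_uv, of "\<bar>\<beta>\<bar>"] by (simp add: R norm_minus_commute)
    show "norm (q w - q v) \<le> \<rho> * (\<bar>\<beta>\<bar> * R)"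
      using lip_wv by (simp add: w R[symmetric] norm_minus_commute)
  qed
  finally have "(1 - \<rho>) * norm (residual q w) \<le> (1 - \<rho>) * (norm m + 2 * \<rho> * (\<bar>\<beta>\<bar> * R))"
    using \<rho> by (intro mult_left_mono) (auto simp: algebra_simps)
  also have "\<dots> \<le> (1 + \<rho>) * (\<rho> * R)"
    using main by (simp add: algebra_simps)
  finally show ?thesis
    using \<rho> by (simp add: R_def field_simps)
qed

text \<open>The vectors \<open>u\<close>, \<open>v\<close>, \<open>s\<close> stand for \<open>x k\<close>, \<open>q (x k)\<close>, \<open>q (q (x k))\<close>, with the fixed
  point moved to the origin.\<close>
lemma least_squares_step_norm_le:
  fixes u v s :: "'a::real_inner" and \<rho> \<beta> :: real
  defines "a \<equiv> v - s" and "r \<equiv> u - v"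
  assumes \<rho>: "0 < \<rho>" "\<rho>\<^sup>2 \<le> 1 - 2 * \<rho>"
    and v_le: "norm v \<le> \<rho> * norm u" and s_le: "norm s \<le> \<rho> * norm v"
    and a_le: "norm a \<le> \<rho> * norm r"
    and orth: "a \<bullet> (a - r) + \<beta> * ((a - r) \<bullet> (a - r)) = 0"
  shows "norm (v + \<beta> *\<^sub>R (v - u)) \<le> norm u"
proof (cases "r = 0")
  case True
  then show ?thesis by (simp add: r_def)
next
  case False
  define R T p where "R = norm r" and "T = (norm u)\<^sup>2 - (norm v)\<^sup>2" and "p = norm v"
  \<comment> \<open>The coefficient of the projection of \<open>a\<close> onto
    \<open>r\<close>.\<close>
  define y where "y = (a \<bullet> r) / R\<^sup>2"
  have R: "R > 0" using False by (simp add: R_def)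
  have "\<rho> < 1 / 2" using \<rho> by (smt (verit) field_sum_of_halves zero_less_power2)
  have p2: "p\<^sup>2 \<le> \<rho>\<^sup>2 * (norm u)\<^sup>2"
    using power_mono[OF v_le, of 2] by (simp add: p_def power_mult_distrib)
  have \<rho>2: "\<rho>\<^sup>2 \<le> (1 / 2)\<^sup>2"
    using \<rho> \<open>\<rho> < 1 / 2\<close> by (intro power_mono) auto
  have "\<rho>\<^sup>2 * (norm u)\<^sup>2 \<le> (1 / 2)\<^sup>2 * (norm u)\<^sup>2"
    using \<rho>2 by (intro mult_right_mono) auto
  with p2 have "4 * p\<^sup>2 \<le> (norm u)\<^sup>2" by (simp add: power_divide)
  moreover have "0 \<le> p\<^sup>2" by simp
  ultimately have pT: "p\<^sup>2 \<le> T" and T: "T \<ge> 0"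
    unfolding T_def p_def by linarith+
  have ar: "a \<bullet> r = y * R\<^sup>2" using R by (simp add: y_def)
  have "a \<bullet> r \<le> norm a * R" by (simp add: R_def norm_cauchy_schwarz)
  also have "\<dots> \<le> \<rho> * R * R"
    using a_le R by (intro mult_right_mono) (auto simp: R_def)
  finally have y: "y \<le> \<rho>" using R by (simp add: ar power2_eq_square)
  have "2 * (v \<bullet> r) = T - R\<^sup>2"
    unfolding T_def R_def r_def power2_norm_eq_inner
    by (simp add: inner_diff_left inner_diff_right inner_commute)
  moreover have "- (s \<bullet> r) \<le> \<rho> * p * R"
  proof -
    have "- (s \<bullet> r) \<le> norm s * R" by (metis R_def abs_le_D2 Cauchy_Schwarz_ineq2)
    also have "\<dots> \<le> \<rho> * p * R"
      using s_le R by (intro mult_right_mono) (auto simp: p_def)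
    finally show ?thesis .
  qed
  ultimately have "2 * (y * R\<^sup>2) \<le> T - R\<^sup>2 + 2 * (\<rho> * p * R)"
    unfolding ar[symmetric] a_def inner_diff_left by (smt (verit))
  \<comment> \<open>Completing the square in \<open>R\<close> leaves
    \<open>\<rho>\<^sup>2 * p\<^sup>2\<close>, where the smallness of \<open>\<rho>\<close> pairs
    with \<open>pT\<close>.\<close>
  moreover have "2 * (\<rho> * p * R) - R\<^sup>2 \<le> (1 - 2 * \<rho>) * T"
  proof -
    have "2 * (\<rho> * p * R) - R\<^sup>2 \<le> \<rho>\<^sup>2 * p\<^sup>2"
      using zero_le_power2[of "\<rho> * p - R"] by (simp add: power2_eq_square algebra_simps)
    also have "\<dots> \<le> (1 - 2 * \<rho>) * T"
      using \<rho> pT \<open>\<rho> < 1 / 2\<close> by (intro mult_mono) auto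
    finally show ?thesis .
  qed
  moreover have "y * T \<le> \<rho> * T" using y T by (intro mult_right_mono) auto
  ultimately have yT: "y * R\<^sup>2 \<le> (1 - y) * T" by (simp add: algebra_simps)

  have aa: "y\<^sup>2 * R\<^sup>2 \<le> a \<bullet> a"
  proof -
    have "(a \<bullet> r)\<^sup>2 \<le> (a \<bullet> a) * (r \<bullet> r)" by (rule Cauchy_Schwarz_ineq)
    then have "(y\<^sup>2 * R\<^sup>2) * R\<^sup>2 \<le> (a \<bullet> a) * R\<^sup>2"
      unfolding ar R_def power2_norm_eq_inner[symmetric]
      by (simp add: power2_eq_square ac_simps)
    then show ?thesis using R by simp
  qed
  define C where "C = (a - r) \<bullet> (a - r)"
  have C: "C = R\<^sup>2 - 2 * (y * R\<^sup>2) + a \<bullet> a"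
    unfolding C_def ar[symmetric] unfolding R_def power2_norm_eq_inner
    by (simp add: inner_diff_left inner_diff_right inner_commute)
  have \<beta>C: "\<beta> * C = y * R\<^sup>2 - a \<bullet> a"
    using orth by (simp add: C_def ar inner_diff_right)
  have "(1 - y)\<^sup>2 * R\<^sup>2 \<le> C"
    using aa by (simp add: C power2_eq_square algebra_simps)
  moreover have "(1 - y)\<^sup>2 * R\<^sup>2 > 0" using y \<open>\<rho> < 1 / 2\<close> R by simp
  ultimately have C0: "C > 0" by linarith
  \<comment> \<open>At \<open>\<beta> = -1\<close> the new point is \<open>u\<close> itself;
    \<open>1 + \<beta>\<close> is a factor in the final identity, so its sign matters.\<close>
  have "\<beta> \<ge> -1"
  proof -
    have "(1 + \<beta>) * C = (1 - y) * R\<^sup>2" unfolding distrib_right \<beta>C by (simp add: C algebra_simps)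
    also have "\<dots> \<ge> 0" using y \<open>\<rho> < 1 / 2\<close> by simp
    finally show ?thesis using C0 by (simp add: zero_le_mult_iff)
  qed
  \<comment> \<open>After multiplication by \<open>C > 0\<close> the claim is hardest for the
    smallest \<open>a \<bullet> a\<close>, that is, for equality in \<open>aa\<close>. There it is
    \<open>yT\<close> times \<open>(1 - y) * R\<^sup>2\<close>.\<close>
  have key: "\<beta> * R\<^sup>2 \<le> T"
  proof -
    have "(y * R\<^sup>2) * (1 - y) \<le> ((1 - y) * T) * (1 - y)"
      using yT y \<open>\<rho> < 1 / 2\<close> by (intro mult_right_mono) auto
    then have "(y * R\<^sup>2) * (1 - y) * R\<^sup>2 \<le> ((1 - y) * T) * (1 - y) * R\<^sup>2"
      by (rule mult_right_mono) simp
    moreover have "y\<^sup>2 * R\<^sup>2 * (R\<^sup>2 + T) \<le> (a \<bullet> a) * (R\<^sup>2 + T)"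
      using aa T by (intro mult_right_mono) auto
    ultimately have "(\<beta> * C) * R\<^sup>2 \<le> T * C"
      unfolding \<beta>C by (simp add: C power2_eq_square algebra_simps)
    then have "(\<beta> * R\<^sup>2) * C \<le> T * C" by (simp add: algebra_simps)
    then show ?thesis using C0 by simp
  qed
  have "(norm (v + \<beta> *\<^sub>R (v - u)))\<^sup>2 = (norm u)\<^sup>2 - (1 + \<beta>) * (T - \<beta> * R\<^sup>2)"
    unfolding norm_extrapolation T_def R_def r_def by (simp add: algebra_simps)
  also have "\<dots> \<le> (norm u)\<^sup>2" using key \<open>\<beta> \<ge> -1\<close> by simp
  finally show ?thesis by (rule power2_le_imp_le) simp
qed

theorem theorem2:
  fixes q :: "real ^ 'n \<Rightarrow> real ^ 'n"
    and x_star :: "real ^ 'n"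
    and x :: "nat \<Rightarrow> real ^ 'n"
    and \<beta> :: "nat \<Rightarrow> real"
    and \<delta> \<rho> \<eta> :: real
  assumes "0 < \<delta>" and "0 < \<rho>" and "\<rho> < 1"
    and fixed_point: "q x_star = x_star"
    and smooth: "lipschitz_continuously_differentiable_on q (cball x_star \<delta>)"
    and contractive: "\<And>u v. u \<in> cball x_star \<delta> \<Longrightarrow> v \<in> cball x_star \<delta> \<Longrightarrow>
                        norm (q u - q v) \<le> \<rho> * norm (u - v)"
    and initial: "x 0 \<in> cball x_star \<delta>"
    and eta: "\<eta> = \<rho> * (1 + \<rho>) / (1 - \<rho>)" and "\<eta> < 1"
    and iterates: "ngmres0 q \<beta> x"
  shows "converges_q_linearly (\<lambda>k. residual q (x k)) 0 \<eta>"
proof -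
  let ?r = "residual q"
  \<comment> \<open>Clearing the denominator, \<open>\<eta> < 1\<close> reads
    \<open>\<rho>\<^sup>2 + 2 * \<rho> < 1\<close>.\<close>
  have \<rho>: "\<rho>\<^sup>2 \<le> 1 - 2 * \<rho>"
    using \<open>\<eta> < 1\<close> \<open>\<rho> < 1\<close> unfolding eta
    by (simp add: divide_simps power2_eq_square algebra_simps)
  have to_star: "norm (q z - x_star) \<le> \<rho> * norm (z - x_star)" if "z \<in> cball x_star \<delta>" for z
    using contractive[OF that, of x_star] \<open>0 < \<delta>\<close> by (simp add: fixed_point)
  have ball_q: "q z \<in> cball x_star \<delta>" if "z \<in> cball x_star \<delta>" for z
  proof -
    have "\<rho> * norm (z - x_star) \<le> 1 * norm (z - x_star)"
      using \<open>\<rho> < 1\<close> by (intro mult_right_mono) auto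
    then show ?thesis
      using to_star[OF that] that by (simp add: dist_norm norm_minus_commute)
  qed
  have step: "x (Suc k) = q (x k) + \<beta> k *\<^sub>R (q (x k) - x k)" for k
    using iterates by (simp add: ngmres0_def)
  have orth: "?r (q (x k)) \<bullet> (?r (q (x k)) - ?r (x k))
      + \<beta> k * ((?r (q (x k)) - ?r (x k)) \<bullet> (?r (q (x k)) - ?r (x k))) = 0" for k
    using iterates by (intro is_arg_min_norm_line) (simp add: ngmres0_def)
  \<comment> \<open>The residual estimate applies contractivity at \<open>x (Suc k)\<close>, so
    invariance of the ball comes first; it follows since the distance to \<open>x_star\<close> never
    grows.\<close>
  have ball: "x k \<in> cball x_star \<delta>" for k
  proof (induction k)
    case (Suc k)
    let ?v = "q (x k)"
    have "norm ((?v - x_star) + \<beta> k *\<^sub>R ((?v - x_star) - (x k - x_star))) \<le> norm (x k - x_star)"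
    proof (rule least_squares_step_norm_le[where s = "q ?v - x_star" and \<rho> = \<rho>])
      show "norm ((?v - x_star) - (q ?v - x_star)) \<le> \<rho> * norm ((x k - x_star) - (?v - x_star))"
        using contractive[OF Suc ball_q[OF Suc]] by simp
    qed (use \<open>0 < \<rho>\<close> \<rho> to_star Suc ball_q orth[of k] in \<open>simp_all add: residual_def\<close>)
    also have "(?v - x_star) + \<beta> k *\<^sub>R ((?v - x_star) - (x k - x_star)) = x (Suc k) - x_star"
      by (simp add: step)
    finally show ?case
      using Suc by (simp add: dist_norm norm_minus_commute)
  qed (rule initial)
  have "norm (?r (x (Suc k))) \<le> \<eta> * norm (?r (x k))" for k
    unfolding eta
    by (rule ngmres0_step_residual[OF \<open>0 < \<rho>\<close> \<open>\<rho> < 1\<close> refl step orth])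
      (intro contractive ball ball_q)+
  then have "norm (?r (x k)) \<le> \<eta> * norm (?r (x (k - 1)))" if "k \<ge> 1" for k
    using that by (cases k) auto
  moreover have "0 < \<eta>" using \<open>0 < \<rho>\<close> \<open>\<rho> < 1\<close> by (simp add: eta)
  ultimately show ?thesis
    using \<open>\<eta> < 1\<close> by (simp add: converges_q_linearly_def)
qed

end
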